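(* For every $A>0$, the function $L$ is a (not necessarily symmetric) metric on $\mathfrak{T}_A$, the set of equivalence classes of labeled triangles of area $A$.
   Context: A labeled triangle $T$ is a (non-degenerate, closed, filled) triangle in the Euclidean plane whose vertices are labeled $v_1,v_2,v_3$ so that the labeling induces the counter-clockwise orientation on the boundary. A label-preserving homeomorphism $f:T\to T'$ between labeled triangles is a homeomorphism with $f(v_i)=v_i'$ for $i=1,2,3$. Its Lipschitz constant is $L(f)=\sup_{x,y\in T,\,x\ne y}\frac{d_{euc}(f(x),f(y))}{d_{euc}(x,y)}$, where $d_{euc}$ is the Euclidean distance. Define $$L(T,T')=\log\big(\inf\{L(f): f:T\to T' \text{ a label-preserving homeomorphism}\}\big).$$ For $A>0$, $\mathfrak{T}_A$ is the set of equivalence classes of labeled triangles with area $A$, where two labeled triangles are equivalent if there is an isometry between them respecting the labeling. $L$ descends to a well-defined function on $\mathfrak{T}_A\times\mathfrak{T}_A$, also denoted $L$. Convention: a metric on a set $X$ is a function $\eta:X\times X\to\mathbb{R}$ such that $\eta(x,x)=0$ for all $x$, $\eta(x,y)>0$ if $x\neq y$, and $\eta(x,y)+\eta(y,z)\ge\eta(x,z)$ for all $x,y,z$ (symmetry is not required). *)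

theory Defs
  imports "HOL-Analysis.Analysis"
begin

text \<open>The components \<open>T $ 1\<close>, \<open>T $ 2\<close>, \<open>T $ 3\<close> are the vertices, in the order of their labels.
  The associated closed filled triangle is their convex hull.\<close>

type_synonym vertices = "real ^ 2 ^ 3"

definition filled :: "vertices \<Rightarrow> (real ^ 2) set" where
  "filled T = convex hull {T $ 1, T $ 2, T $ 3}"

text \<open>The vertices are in counter-clockwise order iff the edge vectors from the first vertex to
  the second and third form a positively oriented basis of the plane.\<close>

definition labeled_triangle :: "vertices \<Rightarrow> bool" where
  "labeled_triangle T \<longleftrightarrow>
     \<not> collinear {T $ 1, T $ 2, T $ 3} \<and>
     det (vector [T $ 2 - T $ 1, T $ 3 - T $ 1] :: real ^ 2 ^ 2) > 0"

definition label_preserving_homeo :: "vertices \<Rightarrow> vertices \<Rightarrow> (real ^ 2 \<Rightarrow> real ^ 2) \<Rightarrow> bool" where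
  "label_preserving_homeo T T' f \<longleftrightarrow>
     (\<exists>g. homeomorphism (filled T) (filled T') f g) \<and> (\<forall>i. f (T $ i) = T' $ i)"

text \<open>The supremum may be infinite, hence it is taken in \<^typ>\<open>ereal\<close>.\<close>

definition Lipschitz_const :: "(real ^ 2) set \<Rightarrow> (real ^ 2 \<Rightarrow> real ^ 2) \<Rightarrow> ereal" where
  "Lipschitz_const S f =
     Sup {ereal (dist (f x) (f y) / dist x y) | x y. x \<in> S \<and> y \<in> S \<and> x \<noteq> y}"

text \<open>For labeled triangles the infimum is a positive real number: it is finite because of the
  affine map matching the vertices, so the conversion to \<^typ>\<open>real\<close> loses nothing.\<close>

definition L :: "vertices \<Rightarrow> vertices \<Rightarrow> real" where
  "L T T' = ln (real_of_ereal
     (Inf {Lipschitz_const (filled T) f | f. label_preserving_homeo T T' f}))"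

definition triangles_of_area :: "real \<Rightarrow> vertices set" where
  "triangles_of_area A = {T. labeled_triangle T \<and> measure lebesgue (filled T) = A}"

definition label_isometry :: "vertices \<Rightarrow> vertices \<Rightarrow> (real ^ 2 \<Rightarrow> real ^ 2) \<Rightarrow> bool" where
  "label_isometry T T' f \<longleftrightarrow>
     bij_betw f (filled T) (filled T') \<and>
     (\<forall>x\<in>filled T. \<forall>y\<in>filled T. dist (f x) (f y) = dist x y) \<and>
     (\<forall>i. f (T $ i) = T' $ i)"

definition triangle_equiv :: "real \<Rightarrow> (vertices \<times> vertices) set" where
  "triangle_equiv A = {(T, T'). T \<in> triangles_of_area A \<and> T' \<in> triangles_of_area A \<and>
     (\<exists>f. label_isometry T T' f)}"

definition triangle_classes :: "real \<Rightarrow> vertices set set" where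
  "triangle_classes A = triangles_of_area A // triangle_equiv A"

text \<open>The value of \<open>L\<close> at any representatives; independence of their choice is shown below.\<close>

definition L_class :: "vertices set \<Rightarrow> vertices set \<Rightarrow> real" where
  "L_class X Y = the_elem (\<Union>T\<in>X. \<Union>T'\<in>Y. {L T T'})"

definition asymmetric_metric_on :: "'a set \<Rightarrow> ('a \<Rightarrow> 'a \<Rightarrow> real) \<Rightarrow> bool" where
  "asymmetric_metric_on X \<eta> \<longleftrightarrow>
     (\<forall>x\<in>X. \<eta> x x = 0) \<and>
     (\<forall>x\<in>X. \<forall>y\<in>X. x \<noteq> y \<longrightarrow> \<eta> x y > 0) \<and>
     (\<forall>x\<in>X. \<forall>y\<in>X. \<forall>z\<in>X. \<eta> x y + \<eta> y z \<ge> \<eta> x z)"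

lemma vertex_in_filled: "T $ i \<in> filled T"
proof -
  have "T $ i \<in> {T $ 1, T $ 2, T $ 3}"
    using exhaust_3[of i] by auto
  then show ?thesis
    unfolding filled_def by (rule hull_inc)
qed

lemma label_isometry_id: "label_isometry T T (\<lambda>x. x)"
  by (simp add: label_isometry_def bij_betw_def)

lemma label_isometry_sym:
  assumes "label_isometry T T' f"
  shows "label_isometry T' T (inv_into (filled T) f)"
proof -
  from assms have bij: "bij_betw f (filled T) (filled T')"
    and iso: "\<And>x y. x \<in> filled T \<Longrightarrow> y \<in> filled T \<Longrightarrow> dist (f x) (f y) = dist x y"
    and lab: "\<And>i. f (T $ i) = T' $ i"
    by (auto simp: label_isometry_def)
  let ?g = "inv_into (filled T) f"
  have g: "bij_betw ?g (filled T') (filled T)"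
    using bij by (rule bij_betw_inv_into)
  have "dist (?g x) (?g y) = dist x y" if "x \<in> filled T'" "y \<in> filled T'" for x y
    using iso[OF bij_betw_apply[OF g that(1)] bij_betw_apply[OF g that(2)]]
    by (simp add: bij_betw_inv_into_right[OF bij] that)
  moreover have "?g (T' $ i) = T $ i" for i
    using bij_betw_inv_into_left[OF bij vertex_in_filled] by (simp add: lab)
  ultimately show ?thesis
    using g by (auto simp: label_isometry_def)
qed

lemma label_isometry_trans:
  assumes "label_isometry T T' f" "label_isometry T' T'' g"
  shows "label_isometry T T'' (g \<circ> f)"
proof -
  have f: "bij_betw f (filled T) (filled T')" and g: "bij_betw g (filled T') (filled T'')"
    using assms by (simp_all add: label_isometry_def)
  show ?thesis
    using assms bij_betw_trans[OF f g] bij_betw_apply[OF f] by (simp add: label_isometry_def)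
qed

lemma equiv_triangle_equiv: "equiv (triangles_of_area A) (triangle_equiv A)"
proof (rule equivI)
  show "refl_on (triangles_of_area A) (triangle_equiv A)"
    unfolding refl_on_def triangle_equiv_def by (blast intro: label_isometry_id)
  show "sym (triangle_equiv A)"
    unfolding sym_def triangle_equiv_def by (blast intro: label_isometry_sym)
  show "trans (triangle_equiv A)"
    unfolding trans_def triangle_equiv_def by (blast intro: label_isometry_trans)
qed (auto simp: triangle_equiv_def)

lemma label_isometry_homeomorphism:
  assumes "label_isometry T T' f"
  shows "homeomorphism (filled T) (filled T') f (inv_into (filled T) f)"
proof -
  have cont: "continuous_on (filled S) h" if "label_isometry S S' h" for S S' h
    unfolding continuous_on_iff
  proof (intro ballI allI impI)
    fix x and e :: real assume "x \<in> filled S" "0 < e"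
    then show "\<exists>d>0. \<forall>x'\<in>filled S. dist x' x < d \<longrightarrow> dist (h x') (h x) < e"
      using that by (intro exI[of _ e]) (simp add: label_isometry_def)
  qed
  have bij: "bij_betw f (filled T) (filled T')"
    using assms by (simp add: label_isometry_def)
  show ?thesis
    unfolding homeomorphism_def
    using bij_betw_imp_surj_on[OF bij] bij_betw_imp_surj_on[OF bij_betw_inv_into[OF bij]]
      bij_betw_inv_into_left[OF bij] bij_betw_inv_into_right[OF bij]
      cont[OF assms] cont[OF label_isometry_sym[OF assms]]
    by blast
qed

lemma Inf_Lipschitz_const_mono:
  assumes \<phi>: "label_isometry T2 T1 \<phi>" and \<psi>: "label_isometry T1' T2' \<psi>"
  shows "Inf {Lipschitz_const (filled T2) f | f. label_preserving_homeo T2 T2' f}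
       \<le> Inf {Lipschitz_const (filled T1) f | f. label_preserving_homeo T1 T1' f}"
proof (rule Inf_mono, clarify)
  fix f assume f: "label_preserving_homeo T1 T1' f"
  then obtain g where fg: "homeomorphism (filled T1) (filled T1') f g"
    by (auto simp: label_preserving_homeo_def)
  let ?h = "\<psi> \<circ> (f \<circ> \<phi>)"
  have "\<exists>k. homeomorphism (filled T2) (filled T2') ?h k"
    using homeomorphism_compose[OF homeomorphism_compose[OF label_isometry_homeomorphism[OF \<phi>] fg]
        label_isometry_homeomorphism[OF \<psi>]] by blast
  moreover have "?h (T2 $ i) = T2' $ i" for i
    using f \<phi> \<psi> by (simp add: label_isometry_def label_preserving_homeo_def)
  ultimately have h: "label_preserving_homeo T2 T2' ?h"
    by (simp add: label_preserving_homeo_def)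
  have "Lipschitz_const (filled T2) ?h \<le> Lipschitz_const (filled T1) f"
    unfolding Lipschitz_const_def
  proof (rule Sup_least, clarify)
    fix x y assume xy: "x \<in> filled T2" "y \<in> filled T2" "x \<noteq> y"
    then have \<phi>xy: "\<phi> x \<in> filled T1" "\<phi> y \<in> filled T1" and d: "dist (\<phi> x) (\<phi> y) = dist x y"
      using \<phi> bij_betw_apply[of \<phi> "filled T2" "filled T1"] by (simp_all add: label_isometry_def)
    have "f (\<phi> x) \<in> filled T1'" "f (\<phi> y) \<in> filled T1'"
      using \<phi>xy fg by (auto simp: homeomorphism_def)
    then have "dist (?h x) (?h y) / dist x y
        = dist (f (\<phi> x)) (f (\<phi> y)) / dist (\<phi> x) (\<phi> y)"
      using \<psi> d by (simp add: label_isometry_def)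
    moreover have "\<phi> x \<noteq> \<phi> y"
      using d xy by auto
    ultimately show "ereal (dist (?h x) (?h y) / dist x y)
        \<le> Sup {ereal (dist (f x) (f y) / dist x y) | x y.
                 x \<in> filled T1 \<and> y \<in> filled T1 \<and> x \<noteq> y}"
      using \<phi>xy by (intro Sup_upper) auto
  qed
  then show "\<exists>a\<in>{Lipschitz_const (filled T2) f | f. label_preserving_homeo T2 T2' f}.
      a \<le> Lipschitz_const (filled T1) f"
    using h by blast
qed

lemma L_congruent2: "congruent2 (triangle_equiv A) (triangle_equiv A) L"
proof (rule congruent2I')
  fix T1 T2 T1' T2'
  assume "(T1, T2) \<in> triangle_equiv A" "(T1', T2') \<in> triangle_equiv A"
  then obtain \<phi> \<psi> where \<phi>: "label_isometry T1 T2 \<phi>" and \<psi>: "label_isometry T1' T2' \<psi>"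
    by (auto simp: triangle_equiv_def)
  show "L T1 T1' = L T2 T2'"
    unfolding L_def
    by (intro arg_cong[where f = "\<lambda>c. ln (real_of_ereal c)"] order_antisym)
      (rule Inf_Lipschitz_const_mono[OF \<phi> label_isometry_sym[OF \<psi>]]
        Inf_Lipschitz_const_mono[OF label_isometry_sym[OF \<phi>] \<psi>])+
qed

lemma L_class_eq:
  assumes "T \<in> triangles_of_area A" "T' \<in> triangles_of_area A"
  shows "L_class (triangle_equiv A `` {T}) (triangle_equiv A `` {T'}) = L T T'"
proof -
  have "congruent2 (triangle_equiv A) (triangle_equiv A) (\<lambda>T T'. {L T T'})"
    using L_congruent2[of A] by (auto simp: congruent2_def)
  from UN_equiv_class2[OF equiv_triangle_equiv equiv_triangle_equiv this assms]
  show ?thesis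
    by (simp add: L_class_def)
qed

end

theory Submission
  imports Defs
begin

text \<open>The delicate point is that two triangles of equal area are congruent if there are
  label-preserving \<open>c\<close>-Lipschitz homeomorphisms \<open>f : T \<rightarrow> T'\<close> for every \<open>c > 1\<close>.
  Such an \<open>f\<close> multiplies areas by at most \<open>c\<^sup>2\<close> and maps the part of \<open>T\<close> within distance \<open>r\<close> of a
  vertex into the part of \<open>T'\<close> within distance \<open>c r\<close> of the corresponding vertex. Since \<open>f\<close> is onto
  and the areas agree, comparing the complements and letting \<open>c \<rightarrow> 1\<close> shows that no angle of \<open>T'\<close>
  is smaller than the corresponding angle of \<open>T\<close>. As the angles have the same sum, they agree,
  and triangles with equal angles and equal areas are congruent. Angles \<open>\<alpha>\<close> are represented by
  \<open>cot \<alpha> = p / D\<close>, where \<open>p\<close> is the inner product of the two edge vectors at the vertex and \<open>D\<close> is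
  twice the area; the angle sum becomes \<open>p\<^sub>1 p\<^sub>2 + p\<^sub>2 p\<^sub>3 + p\<^sub>3 p\<^sub>1 = D\<^sup>2\<close>.\<close>

section \<open>Lipschitz images\<close>

text \<open>Vitali covering: up to a null set, \<open>S\<close> is covered by countably many
  disjoint closed balls centred in \<open>S\<close> and contained in an open set of barely larger
  measure. On each ball \<open>f\<close> lands in a ball with radius scaled by \<open>c\<close>, so
  volumes scale exactly by \<open>c ^ DIM('a)\<close>, and the leftover null set has null
  image.\<close>

lemma measure_Lipschitz_image_le:
  fixes f :: "'a::euclidean_space \<Rightarrow> 'a"
  assumes S: "compact S" and f: "c-lipschitz_on S f"
  shows "measure lebesgue (f ` S) \<le> c ^ DIM('a) * measure lebesgue S"
proof (rule field_le_epsilon)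
  fix e :: real assume e: "0 < e"
  have c: "0 \<le> c"
    using f by (rule lipschitz_on_nonneg)
  have S_meas: "S \<in> lmeasurable"
    using S by (rule lmeasurable_compact)
  define \<delta> where "\<delta> = e / (c ^ DIM('a) + 1)"
  have cpos: "0 < c ^ DIM('a) + 1"
    using c by (simp add: add_nonneg_pos)
  then have \<delta>: "0 < \<delta>"
    using e by (simp add: \<delta>_def)
  obtain U where U: "open U" "S \<subseteq> U" "U - S \<in> lmeasurable" "emeasure lebesgue (U - S) < ennreal \<delta>"
    using sets_lebesgue_outer_open[OF fmeasurableD[OF S_meas] \<delta>] by blast
  have U_eq: "U = S \<union> (U - S)"
    using U(2) by blast
  have U_meas: "U \<in> lmeasurable"
    using S_meas U(3) by (subst U_eq) (rule fmeasurable.Un)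
  have "measure lebesgue (U - S) < \<delta>"
    using U(4) \<delta> emeasure_eq_measure2[OF U(3)] by (simp add: ennreal_less_iff)
  moreover have "measure lebesgue U = measure lebesgue (S \<union> (U - S))"
    using U_eq by (rule arg_cong)
  ultimately have U_le: "measure lebesgue U \<le> measure lebesgue S + \<delta>"
    using measure_Un_le[OF fmeasurableD[OF S_meas] fmeasurableD[OF U(3)]] by linarith
  define K where "K = {(a, r). a \<in> S \<and> 0 < r \<and> cball a r \<subseteq> U}"
  have "\<exists>i. i \<in> K \<and> x \<in> cball (fst i) (snd i) \<and> snd i < d" if "x \<in> S" "0 < d" for x d
  proof -
    have "x \<in> U"
      using U(2) that(1) by blast
    then obtain \<epsilon> where \<epsilon>: "0 < \<epsilon>" "cball x \<epsilon> \<subseteq> U"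
      using open_contains_cball[THEN iffD1, OF U(1)] by blast
    have "cball x (min \<epsilon> (d / 2)) \<subseteq> U"
      using \<epsilon>(2) by (rule order_trans[rotated]) (rule subset_cball, simp)
    then have "(x, min \<epsilon> (d / 2)) \<in> K"
      using that \<epsilon>(1) by (simp add: K_def)
    then show ?thesis
      using that \<epsilon>(1) by (intro exI[of _ "(x, min \<epsilon> (d / 2))"]) simp
  qed
  moreover have "0 < snd i" if "i \<in> K" for i
    using that by (auto simp: K_def)
  ultimately obtain C where C: "countable C" "C \<subseteq> K"
      and disj: "pairwise (\<lambda>i j. disjnt (cball (fst i) (snd i)) (cball (fst j) (snd j))) C"
      and neg: "negligible (S - (\<Union>i\<in>C. cball (fst i) (snd i)))"
    using Vitali_covering_theorem_cballs[of K snd S fst] by blast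
  let ?N = "S - (\<Union>i\<in>C. cball (fst i) (snd i))"
  \<comment> \<open>Since the centre of the ball lies in \<open>S\<close>, \<open>?B i\<close>
    contains the image of the part of \<open>S\<close> in the \<open>i\<close>-th ball.\<close>
  let ?B = "\<lambda>i. cball (f (fst i)) (c * snd i)"
  have B_measure: "measure lebesgue (?B i) = c ^ DIM('a) * measure lebesgue (cball (fst i) (snd i))"
    if "i \<in> C" for i
    using that C c by (auto simp: content_cball K_def power_mult_distrib)
  have fN: "negligible (f ` ?N)"
    by (rule negligible_locally_Lipschitz_image[OF order_refl neg])
      (auto intro!: exI[of _ UNIV] exI[of _ c] lipschitz_on_normD[OF f])
  \<comment> \<open>A bound uniform over finite subfamilies passes to the countable union.
    Disjointness is what bounds the sum of the ball volumes by the measure of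
    \<open>U\<close>.\<close>
  have bound: "measure lebesgue (\<Union>i\<in>I. ?B i) \<le> c ^ DIM('a) * measure lebesgue U"
    if I: "I \<subseteq> C" "finite I" for I
  proof -
    have "measure lebesgue (\<Union>i\<in>I. ?B i) \<le> (\<Sum>i\<in>I. measure lebesgue (?B i))"
      using I by (intro measure_UNION_le) auto
    also have "\<dots> = c ^ DIM('a) * (\<Sum>i\<in>I. measure lebesgue (cball (fst i) (snd i)))"
      unfolding sum_distrib_left using I by (intro sum.cong B_measure) auto
    also have "(\<Sum>i\<in>I. measure lebesgue (cball (fst i) (snd i)))
        = measure lebesgue (\<Union>i\<in>I. cball (fst i) (snd i))"
    proof (rule measure_finite_Union[symmetric])
      show "disjoint_family_on (\<lambda>i. cball (fst i) (snd i)) I"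
        using disj I(1) unfolding disjoint_family_on_def pairwise_def disjnt_def by blast
    qed (use I fmeasurableD2[OF lmeasurable_cball] in auto)
    also have "\<dots> \<le> measure lebesgue U"
    proof (rule measure_mono_fmeasurable)
      have "cball (fst i) (snd i) \<subseteq> U" if "i \<in> I" for i
        using subsetD[OF C(2) subsetD[OF I(1) that]] by (simp add: K_def case_prod_beta)
      then show "(\<Union>i\<in>I. cball (fst i) (snd i)) \<subseteq> U"
        by blast
    qed (use I U_meas in auto)
    finally show ?thesis
      using c by (simp add: mult_left_mono)
  qed
  have B_meas: "(\<Union>i\<in>C. ?B i) \<in> lmeasurable"
      and B_le: "measure lebesgue (\<Union>i\<in>C. ?B i) \<le> c ^ DIM('a) * measure lebesgue U"
    using fmeasurable_UN_bound[OF C(1) _ bound] measure_UN_bound[OF C(1) _ bound] by auto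
  have "f ` S \<subseteq> (\<Union>i\<in>C. ?B i) \<union> f ` ?N"
  proof clarify
    fix x assume x: "x \<in> S" "f x \<notin> f ` ?N"
    then obtain i where i: "i \<in> C" "x \<in> cball (fst i) (snd i)"
      by blast
    then have "fst i \<in> S"
      using C by (auto simp: K_def)
    then have "dist (f (fst i)) (f x) \<le> c * dist (fst i) x"
      using x lipschitz_onD[OF f] by blast
    also have "\<dots> \<le> c * snd i"
      using c i by (intro mult_left_mono) auto
    finally show "f x \<in> (\<Union>i\<in>C. ?B i)"
      using i by auto
  qed
  moreover have "compact (f ` S)"
    using S lipschitz_on_continuous_on[OF f] by (rule compact_continuous_image[rotated])
  ultimately have "measure lebesgue (f ` S) \<le> measure lebesgue ((\<Union>i\<in>C. ?B i) \<union> f ` ?N)"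
    using B_meas fN
    by (intro measure_mono_fmeasurable)
      (auto intro: fmeasurableD lmeasurable_compact fmeasurable.Un negligible_imp_measurable)
  also have "\<dots> \<le> measure lebesgue (\<Union>i\<in>C. ?B i) + measure lebesgue (f ` ?N)"
    using B_meas fN by (intro measure_Un_le) (auto simp: fmeasurableD negligible_imp_sets)
  also have "measure lebesgue (f ` ?N) = 0"
    using fN by (rule negligible_imp_measure0)
  also have "measure lebesgue (\<Union>i\<in>C. ?B i) + 0 \<le> c ^ DIM('a) * (measure lebesgue S + \<delta>)"
    using B_le mult_left_mono[OF U_le, of "c ^ DIM('a)"] c by simp
  also have "\<dots> \<le> c ^ DIM('a) * measure lebesgue S + e"
  proof -
    have "c ^ DIM('a) * \<delta> \<le> (c ^ DIM('a) + 1) * \<delta>"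
      using \<delta> by (intro mult_right_mono) auto
    also have "\<dots> = e"
      using cpos by (simp add: \<delta>_def)
    finally show ?thesis
      by (simp add: distrib_left)
  qed
  finally show "measure lebesgue (f ` S) \<le> c ^ DIM('a) * measure lebesgue S + e" .
qed

section \<open>Corners of triangles\<close>

text \<open>The sector from the positive first axis counter-clockwise to the direction
  \<open>(k, 1)\<close>, so its angle has cotangent \<open>k\<close>. The cotangent treats acute,
  right and obtuse angles uniformly.\<close>

definition wedge :: "real \<Rightarrow> (real ^ 2) set" where
  "wedge k = {x. 0 \<le> x $ 2 \<and> k * x $ 2 \<le> x $ 1}"

text \<open>Half the angle whose cotangent is \<open>k\<close>, expressed as an area so that angles
  can be compared by measure.\<close>

definition wedge_area :: "real \<Rightarrow> real" where
  "wedge_area k = measure lebesgue (wedge k \<inter> ball 0 1)"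

lemma lmeasurable_wedge_ball: "wedge k \<inter> ball a r \<in> lmeasurable"
proof -
  have "closed (wedge k)"
    unfolding wedge_def
    by (intro closed_Collect_conj closed_Collect_le continuous_intros)
  then show ?thesis
    by (intro bounded_set_imp_lmeasurable bounded_Int) auto
qed

lemma measure_wedge_ball:
  assumes "0 < r"
  shows "measure lebesgue (wedge k \<inter> ball 0 r) = r\<^sup>2 * wedge_area k"
proof -
  have "wedge k \<inter> ball 0 r = (\<lambda>x. r *\<^sub>R x + 0) ` (wedge k \<inter> ball 0 1)"
  proof (intro equalityI subsetI)
    fix x assume x: "x \<in> wedge k \<inter> ball 0 r"
    have "k * (x $ 2 / r) \<le> x $ 1 / r"
      using x assms by (simp add: wedge_def divide_right_mono)
    then have "(1 / r) *\<^sub>R x \<in> wedge k \<inter> ball 0 1"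
      using x assms by (simp add: wedge_def)
    moreover have "x = r *\<^sub>R ((1 / r) *\<^sub>R x) + 0"
      using assms by simp
    ultimately show "x \<in> (\<lambda>x. r *\<^sub>R x + 0) ` (wedge k \<inter> ball 0 1)"
      by blast
  next
    fix x assume "x \<in> (\<lambda>x. r *\<^sub>R x + 0) ` (wedge k \<inter> ball 0 1)"
    then obtain y where y: "y \<in> wedge k" "norm y < 1" "x = r *\<^sub>R y"
      by auto
    have "r * (k * y $ 2) \<le> r * y $ 1"
      using y assms by (simp add: wedge_def)
    then show "x \<in> wedge k \<inter> ball 0 r"
      using y assms by (simp add: wedge_def algebra_simps)
  qed
  then show ?thesis
    using measure_lebesgue_affine[of r 0 "wedge k \<inter> ball 0 1"] assms by (simp add: wedge_area_def)
qed

text \<open>The open set \<open>G\<close> strictly between the two bounding rays lies in the wider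
  sector, misses the narrower one, and has positive measure because it is nonempty.\<close>

lemma wedge_area_strict_antimono:
  assumes "k < k'"
  shows "wedge_area k' < wedge_area k"
proof -
  let ?W = "\<lambda>k. wedge k \<inter> ball 0 1"
  define G :: "(real ^ 2) set"
    where "G = ball 0 1 \<inter> ({x. 0 < x $ 2} \<inter> ({x. k * x $ 2 < x $ 1} \<inter> {x. x $ 1 < k' * x $ 2}))"
  have "open G"
    unfolding G_def by (intro open_Int open_ball open_Collect_less continuous_intros)
  moreover have "G \<noteq> {}"
  proof -
    \<comment> \<open>A direction between the rays \<open>(k, 1)\<close> and \<open>(k', 1)\<close>;
      the factor \<open>t\<close> shrinks it to norm \<open>1 / 2\<close>.\<close>
    define y :: "real ^ 2" where "y = vector [(k + k') / 2, 1]"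
    define t where "t = 1 / (2 * norm y)"
    have "y $ 2 = 1" "y $ 1 = (k + k') / 2"
      by (simp_all add: y_def)
    moreover from this have "y \<noteq> 0"
      by auto
    then have "0 < t" "t * norm y < 1"
      by (simp_all add: t_def)
    moreover have "t * k < t * ((k + k') / 2)" "t * ((k + k') / 2) < t * k'"
      using assms \<open>0 < t\<close> by simp_all
    ultimately have "t *\<^sub>R y \<in> G"
      by (simp add: G_def algebra_simps)
    then show ?thesis
      by blast
  qed
  ultimately have "\<not> negligible G"
    by (rule open_not_negligible)
  moreover have G: "G \<in> lmeasurable"
    using \<open>open G\<close> by (intro lmeasurable_open) (auto simp: G_def intro: bounded_Int)
  ultimately have "0 < measure lebesgue G"
    using negligible_iff_measure[of G] by (simp add: zero_less_measure_iff)
  have "G \<subseteq> ?W k"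
    by (auto simp: G_def wedge_def)
  have sub: "?W k' \<subseteq> ?W k - G"
  proof
    fix x assume x: "x \<in> ?W k'"
    then have "k * x $ 2 \<le> k' * x $ 2"
      using assms by (intro mult_right_mono) (auto simp: wedge_def)
    then show "x \<in> ?W k - G"
      using x by (auto simp: wedge_def G_def)
  qed
  have "measure lebesgue (?W k') \<le> measure lebesgue (?W k - G)"
    using sub by (rule measure_mono_fmeasurable)
      (auto intro: fmeasurableD fmeasurable.Diff lmeasurable_wedge_ball G)
  also have "\<dots> = measure lebesgue (?W k) - measure lebesgue G"
    by (rule measurable_measure_Diff[OF lmeasurable_wedge_ball fmeasurableD[OF G] \<open>G \<subseteq> ?W k\<close>])
  finally show ?thesis
    using \<open>0 < measure lebesgue G\<close> by (simp add: wedge_area_def)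
qed

section \<open>Areas of triangles and of their corners\<close>

definition cross :: "real ^ 2 \<Rightarrow> real ^ 2 \<Rightarrow> real" where
  "cross u v = u $ 1 * v $ 2 - u $ 2 * v $ 1"

lemma inner_2: "u \<bullet> v = u $ 1 * v $ 1 + u $ 2 * v $ 2" for u v :: "real ^ 2"
  by (simp add: inner_vec_def UNIV_2)

lemma measure_triangle:
  fixes a b c :: "real ^ 2"
  shows "measure lebesgue (convex hull {a, b, c}) = \<bar>cross (b - a) (c - a)\<bar> / 2"
proof -
  have "compact (convex hull {a, b, c})"
    by (intro compact_convex_hull finite_imp_compact) simp
  then have "measure lebesgue (convex hull {a, b, c}) = measure lborel (convex hull {a, b, c})"
    by (intro measure_completion) (simp add: borel_compact)
  then show ?thesis
    by (simp add: content_triangle cross_def algebra_simps abs_minus_commute)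
qed

text \<open>Near a corner with angle \<open>\<alpha>\<close>, a triangle is a rotated copy of the wedge of parameter \<open>cot \<alpha>\<close>.\<close>

lemma
  fixes a b c :: "real ^ 2"
  defines "D \<equiv> cross (b - a) (c - a)" and "p \<equiv> (b - a) \<bullet> (c - a)"
  assumes D: "0 < D"
  shows measure_corner_le:
      "0 < r \<Longrightarrow> measure lebesgue (convex hull {a, b, c} \<inter> ball a r) \<le> r\<^sup>2 * wedge_area (p / D)"
    and measure_corner_eq:
      "\<exists>r>0. measure lebesgue (convex hull {a, b, c} \<inter> ball a r) = r\<^sup>2 * wedge_area (p / D)"
proof -
  define u where "u = b - a"
  define v where "v = c - a"
  define k where "k = p / D"
  define n where "n = norm u"
  let ?S = "convex hull {a, b, c}"
  have Duv: "D = u $ 1 * v $ 2 - u $ 2 * v $ 1" and puv: "p = u $ 1 * v $ 1 + u $ 2 * v $ 2"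
    by (simp_all add: D_def p_def cross_def inner_2 u_def v_def)
  have n2: "n * n = u $ 1 * u $ 1 + u $ 2 * u $ 2"
    unfolding n_def by (metis inner_2 power2_eq_square power2_norm_eq_inner)
  have "u \<noteq> 0"
    using D Duv by auto
  then have n: "0 < n"
    by (simp add: n_def)
  \<comment> \<open>The rotation taking \<open>u\<close> to the positive first axis.\<close>
  define R :: "real ^ 2 \<Rightarrow> real ^ 2"
    where "R x = vector [(u $ 1 * x $ 1 + u $ 2 * x $ 2) / n, (u $ 1 * x $ 2 - u $ 2 * x $ 1) / n]" for x
  have R1: "R x $ 1 = (u $ 1 * x $ 1 + u $ 2 * x $ 2) / n"
    and R2: "R x $ 2 = (u $ 1 * x $ 2 - u $ 2 * x $ 1) / n" for x
    by (simp_all add: R_def)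
  have R_linear: "linear R"
    by (rule linearI) (simp_all add: vec_eq_iff forall_2 R1 R2 field_simps add_divide_distrib diff_divide_distrib)
  have R_norm: "norm (R x) = norm x" for x
  proof -
    have "(u $ 1 * x $ 1 + u $ 2 * x $ 2)\<^sup>2 + (u $ 1 * x $ 2 - u $ 2 * x $ 1)\<^sup>2
        = (n * n) * (x $ 1 * x $ 1 + x $ 2 * x $ 2)"
      unfolding n2 power2_eq_square by algebra
    then have "R x \<bullet> R x = x \<bullet> x"
      using n by (simp add: inner_2 R1 R2 power2_eq_square add_divide_distrib[symmetric])
    then show ?thesis
      by (simp add: norm_eq_sqrt_inner)
  qed
  have R: "orthogonal_transformation R"
    using R_linear R_norm by (simp add: orthogonal_transformation)
  \<comment> \<open>Moves the corner to the origin and the edge \<open>u\<close> onto the first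
    axis; as \<open>D\<close> is positive, \<open>v\<close> then points into the upper half
    plane.\<close>
  define \<phi> where "\<phi> x = R (x - a)" for x
  have S_eq: "?S = {a + s *\<^sub>R u + t *\<^sub>R v | s t. 0 \<le> s \<and> 0 \<le> t \<and> s + t \<le> 1}"
    unfolding u_def v_def by (rule convex_hull_3_alt)
  have \<phi>1: "\<phi> (a + s *\<^sub>R u + t *\<^sub>R v) $ 1 = s * n + t * (p / n)"
    and \<phi>2: "\<phi> (a + s *\<^sub>R u + t *\<^sub>R v) $ 2 = t * (D / n)" for s t
  proof -
    have "u $ 1 * (s * u $ 1 + t * v $ 1) + u $ 2 * (s * u $ 2 + t * v $ 2) = s * (n * n) + t * p"
      unfolding n2 puv by algebra
    then show "\<phi> (a + s *\<^sub>R u + t *\<^sub>R v) $ 1 = s * n + t * (p / n)"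
      using n by (simp add: \<phi>_def R1 add_divide_distrib)
    have "u $ 1 * (s * u $ 2 + t * v $ 2) - u $ 2 * (s * u $ 1 + t * v $ 1) = t * D"
      unfolding Duv by algebra
    then show "\<phi> (a + s *\<^sub>R u + t *\<^sub>R v) $ 2 = t * (D / n)"
      by (simp add: \<phi>_def R2)
  qed
  have \<phi>_norm: "norm (\<phi> x) = dist a x" for x
    by (simp add: \<phi>_def R_norm dist_norm norm_minus_commute)
  have S_meas: "?S \<inter> ball a r \<in> lmeasurable" for r
    by (intro fmeasurable.Int lmeasurable_ball lmeasurable_compact compact_convex_hull finite_imp_compact) simp
  have \<phi>_measure: "measure lebesgue (\<phi> ` (?S \<inter> ball a r)) = measure lebesgue (?S \<inter> ball a r)"
    and \<phi>_meas: "\<phi> ` (?S \<inter> ball a r) \<in> lmeasurable" for r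
  proof -
    have "\<phi> ` (?S \<inter> ball a r) = R ` (\<lambda>x. x - a) ` (?S \<inter> ball a r)"
      by (simp add: \<phi>_def image_image)
    then show "measure lebesgue (\<phi> ` (?S \<inter> ball a r)) = measure lebesgue (?S \<inter> ball a r)"
      and "\<phi> ` (?S \<inter> ball a r) \<in> lmeasurable"
      using measure_orthogonal_image[OF R measurable_translation_subtract[OF S_meas]]
        measurable_orthogonal_image[OF R measurable_translation_subtract[OF S_meas]]
      by (simp_all add: measure_translation_subtract)
  qed
  have sub: "\<phi> ` (?S \<inter> ball a r) \<subseteq> wedge k \<inter> ball 0 r" for r
  proof
    fix y assume "y \<in> \<phi> ` (?S \<inter> ball a r)"
    then obtain s t where st: "0 \<le> s" "0 \<le> t" and y: "y = \<phi> (a + s *\<^sub>R u + t *\<^sub>R v)"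
        "dist a (a + s *\<^sub>R u + t *\<^sub>R v) < r"
      unfolding S_eq by auto
    have "k * (t * (D / n)) = t * (p / n)"
      using D by (simp add: k_def)
    moreover have "0 \<le> s * n"
      using st n by simp
    ultimately have "k * y $ 2 \<le> y $ 1"
      unfolding y(1) \<phi>1 \<phi>2 by linarith
    moreover have "0 \<le> y $ 2"
      using st n D by (simp add: y(1) \<phi>2)
    ultimately show "y \<in> wedge k \<inter> ball 0 r"
      using y by (simp add: wedge_def \<phi>_norm)
  qed
  show "measure lebesgue (?S \<inter> ball a r) \<le> r\<^sup>2 * wedge_area (p / D)" if "0 < r" for r
    using measure_mono_fmeasurable[OF sub fmeasurableD[OF \<phi>_meas] lmeasurable_wedge_ball, of r]
      measure_wedge_ball[OF that, of k]
    by (simp add: \<phi>_measure k_def)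
  \<comment> \<open>A point of the wedge with norm below \<open>1 / m\<close> has coordinates
    \<open>s \<le> (1 + \<bar>k\<bar>) / (m * n)\<close> and \<open>t \<le> n / (m * D)\<close>,
    which sum to at most 1. So the opposite side does not cut the sector off within this
    radius.\<close>
  define m where "m = (1 + \<bar>k\<bar>) / n + n / D"
  have m: "0 < m"
    using n D by (simp add: m_def add_pos_pos)
  have "wedge k \<inter> ball 0 (1 / m) \<subseteq> \<phi> ` (?S \<inter> ball a (1 / m))"
  proof
    fix y assume "y \<in> wedge k \<inter> ball 0 (1 / m)"
    then have y: "0 \<le> y $ 2" "k * y $ 2 \<le> y $ 1" "norm y < 1 / m"
      by (auto simp: wedge_def)
    \<comment> \<open>The solution \<open>s\<close>, \<open>t\<close> of the triangular system given
      by the two coordinate formulas for \<open>\<phi>\<close>.\<close>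
    define s where "s = (y $ 1 - k * y $ 2) / n"
    define t where "t = y $ 2 * n / D"
    have st: "0 \<le> s" "0 \<le> t"
      using y n D by (simp_all add: s_def t_def)
    have y12: "\<bar>y $ 1\<bar> \<le> 1 / m" "\<bar>y $ 2\<bar> \<le> 1 / m"
      using y component_le_norm_cart[of y] by (meson less_imp_le order_trans)+
    have "\<bar>k\<bar> * \<bar>y $ 2\<bar> \<le> \<bar>k\<bar> * (1 / m)"
      using y12 by (intro mult_left_mono) auto
    then have "y $ 1 - k * y $ 2 \<le> (1 + \<bar>k\<bar>) * (1 / m)"
      using y12 abs_le_D2[of "k * y $ 2" "\<bar>k\<bar> * (1 / m)"] by (simp add: abs_mult add_divide_distrib)
    then have "s \<le> (1 + \<bar>k\<bar>) * (1 / m) / n"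
      using n unfolding s_def by (intro divide_right_mono) auto
    moreover have "t \<le> (1 / m) * n / D"
      using y12 n D unfolding t_def by (intro divide_right_mono mult_right_mono) auto
    moreover have "(1 + \<bar>k\<bar>) * (1 / m) / n + (1 / m) * n / D = (1 / m) * m"
      unfolding m_def by (simp only: distrib_left) (simp add: algebra_simps)
    ultimately have "s + t \<le> 1"
      using m by simp
    then have "a + s *\<^sub>R u + t *\<^sub>R v \<in> ?S"
      unfolding S_eq using st by blast
    moreover have y_eq: "y = \<phi> (a + s *\<^sub>R u + t *\<^sub>R v)"
    proof -
      have "s * n + t * (p / n) = y $ 1" "t * (D / n) = y $ 2"
        using n D by (simp_all add: s_def t_def k_def)
      then show ?thesis
        by (simp add: vec_eq_iff forall_2 \<phi>1 \<phi>2)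
    qed
    moreover have "a + s *\<^sub>R u + t *\<^sub>R v \<in> ball a (1 / m)"
      using y(3) unfolding y_eq \<phi>_norm mem_ball .
    ultimately show "y \<in> \<phi> ` (?S \<inter> ball a (1 / m))"
      by (intro image_eqI[where x = "a + s *\<^sub>R u + t *\<^sub>R v"]) simp_all
  qed
  with sub[of "1 / m"] have "\<phi> ` (?S \<inter> ball a (1 / m)) = wedge k \<inter> ball 0 (1 / m)"
    by (rule equalityI)
  then have "measure lebesgue (?S \<inter> ball a (1 / m)) = (1 / m)\<^sup>2 * wedge_area (p / D)"
    using \<phi>_measure[of "1 / m"] measure_wedge_ball[of "1 / m" k] m by (simp add: k_def)
  then show "\<exists>r>0. measure lebesgue (?S \<inter> ball a r) = r\<^sup>2 * wedge_area (p / D)"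
    using m by (intro exI[of _ "1 / m"]) simp
qed

text \<open>With \<open>cross\<close> equal for both triangles, comparing inner products means
  comparing cotangents. A smaller angle at \<open>a'\<close> would leave more area outside the
  corner of \<open>S'\<close> than \<open>f\<close> can cover from outside the corner of
  \<open>S\<close>.\<close>

lemma corner_inner_le:
  fixes a b c a' b' c' :: "real ^ 2"
  defines "S \<equiv> convex hull {a, b, c}" and "S' \<equiv> convex hull {a', b', c'}"
  assumes D: "0 < cross (b - a) (c - a)"
    and D': "cross (b' - a') (c' - a') = cross (b - a) (c - a)"
    and ex: "\<And>e. 1 < e \<Longrightarrow> \<exists>f. e-lipschitz_on S f \<and> f ` S = S' \<and> f a = a'"
  shows "(b' - a') \<bullet> (c' - a') \<le> (b - a) \<bullet> (c - a)"
proof (rule ccontr)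
  let ?D = "cross (b - a) (c - a)"
  let ?k = "(b - a) \<bullet> (c - a) / ?D" and ?k' = "(b' - a') \<bullet> (c' - a') / ?D"
  assume "\<not> ?thesis"
  then have "?k < ?k'"
    using D by (simp add: divide_strict_right_mono)
  then have less: "wedge_area ?k' < wedge_area ?k"
    by (rule wedge_area_strict_antimono)
  obtain r where r: "0 < r" and eq: "measure lebesgue (S \<inter> ball a r) = r\<^sup>2 * wedge_area ?k"
    using measure_corner_eq[OF D] unfolding S_def by blast
  \<comment> \<open>The area by which the corner at \<open>a\<close> would exceed the one at
    \<open>a'\<close>.\<close>
  define q where "q = r\<^sup>2 * (wedge_area ?k - wedge_area ?k')"
  have q: "0 < q"
    using r less by (simp add: q_def)
  \<comment> \<open>Close enough to 1 that \<open>e\<^sup>2 * (?D / 2 - q)\<close> stays below the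
    area \<open>?D / 2\<close>, which is the final contradiction.\<close>
  define e where "e = sqrt (1 + q / ?D)"
  have e: "1 < e" and e2: "e\<^sup>2 = 1 + q / ?D"
    using q D by (simp_all add: e_def)
  obtain f where f: "e-lipschitz_on S f" "f ` S = S'" "f a = a'"
    using ex[OF e] by blast
  have S: "compact S" and S': "compact S'"
    unfolding S_def S'_def by (simp_all add: compact_convex_hull finite_imp_compact)
  have "a \<in> S"
    unfolding S_def by (simp add: hull_inc)
  have meas: "S \<inter> ball a r \<in> lmeasurable" "S' \<inter> ball a' (e * r) \<in> lmeasurable"
    using S S' by (auto intro: fmeasurable.Int lmeasurable_compact)
  have X: "compact (S - ball a r)"
    using S by (rule compact_diff) simp
  have fX: "compact (f ` (S - ball a r))"
    using X lipschitz_on_continuous_on[OF f(1)]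
    by (intro compact_continuous_image) (auto intro: continuous_on_subset)
  \<comment> \<open>Points of \<open>S\<close> near \<open>a\<close> stay within
    \<open>e * r\<close> of \<open>a'\<close>, so by surjectivity the rest of \<open>S'\<close> must
    come from outside the corner.\<close>
  have "S' \<subseteq> f ` (S - ball a r) \<union> (S' \<inter> ball a' (e * r))"
  proof
    fix y assume y: "y \<in> S'"
    then obtain x where x: "x \<in> S" "y = f x"
      using f(2) by blast
    have "y \<in> ball a' (e * r)" if "x \<in> ball a r"
    proof -
      have "dist (f a) (f x) \<le> e * dist a x"
        using lipschitz_onD[OF f(1) \<open>a \<in> S\<close> x(1)] .
      also have "\<dots> < e * r"
        using that e by simp
      finally show ?thesis
        by (simp add: f(3) x(2))
    qed
    then show "y \<in> f ` (S - ball a r) \<union> (S' \<inter> ball a' (e * r))"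
      using x y by blast
  qed
  then have "measure lebesgue S' \<le> measure lebesgue (f ` (S - ball a r) \<union> (S' \<inter> ball a' (e * r)))"
    using S' fX meas
    by (intro measure_mono_fmeasurable) (auto intro: fmeasurable.Un lmeasurable_compact fmeasurableD)
  also have "\<dots> \<le> measure lebesgue (f ` (S - ball a r)) + measure lebesgue (S' \<inter> ball a' (e * r))"
    using fX meas by (intro measure_Un_le) (auto intro: lmeasurable_compact fmeasurableD)
  also have "measure lebesgue (f ` (S - ball a r)) \<le> e\<^sup>2 * measure lebesgue (S - ball a r)"
    using measure_Lipschitz_image_le[OF X lipschitz_on_subset[OF f(1)]] by simp
  also have "measure lebesgue (S - ball a r) = measure lebesgue (S - (S \<inter> ball a r))"
    by (simp add: Diff_Int)
  also have "\<dots> = ?D / 2 - r\<^sup>2 * wedge_area ?k"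
    using D eq measurable_measure_Diff[OF lmeasurable_compact[OF S] fmeasurableD[OF meas(1)]]
    by (simp add: S_def measure_triangle)
  also have "measure lebesgue (S' \<inter> ball a' (e * r)) \<le> (e * r)\<^sup>2 * wedge_area ?k'"
    using measure_corner_le[where a = a' and b = b' and c = c' and r = "e * r"] D D' e r unfolding S'_def by simp
  finally have "?D / 2 \<le> e\<^sup>2 * (?D / 2 - r\<^sup>2 * wedge_area ?k) + (e * r)\<^sup>2 * wedge_area ?k'"
    using D D' by (simp add: S'_def measure_triangle)
  also have "\<dots> = e\<^sup>2 * (?D / 2 - q)"
    by (simp add: q_def algebra_simps power_mult_distrib)
  also have "\<dots> = ?D / 2 - q / 2 - q\<^sup>2 / ?D"
    unfolding e2 using D by (simp add: field_simps power2_eq_square)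
  also have "\<dots> < ?D / 2"
    using q divide_pos_pos[OF zero_less_power[OF q, of 2] D] by linarith
  finally show False
    by simp
qed

text \<open>Twice the difference of the two quadratic expressions is a sum of the differences
  \<open>p - p'\<close>, \<open>q - q'\<close>, \<open>r - r'\<close> with positive weights, so none
  of these nonnegative differences can be positive.\<close>

lemma eq_if_sum_pairwise_products_eq:
  fixes p q r p' q' r' :: real
  assumes le: "p' \<le> p" "q' \<le> q" "r' \<le> r"
    and pos: "0 < p + q" "0 < q + r" "0 < r + p" "0 < p' + q'" "0 < q' + r'" "0 < r' + p'"
    and eq: "p' * q' + q' * r' + r' * p' = p * q + q * r + r * p"
  shows "p' = p" "q' = q" "r' = r"
proof -
  define x where "x = (p - p') * ((q + r) + (q' + r'))"
  define y where "y = (q - q') * ((r + p) + (r' + p'))"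
  define z where "z = (r - r') * ((p + q) + (p' + q'))"
  have "x + y + z = 2 * ((p * q + q * r + r * p) - (p' * q' + q' * r' + r' * p'))"
    unfolding x_def y_def z_def by algebra
  then have "x + y + z = 0"
    using eq by simp
  moreover have "0 \<le> x" "0 \<le> y" "0 \<le> z"
    unfolding x_def y_def z_def using le pos by (intro mult_nonneg_nonneg; linarith)+
  ultimately have "x = 0" "y = 0" "z = 0"
    by linarith+
  then show "p' = p" "q' = q" "r' = r"
    unfolding x_def y_def z_def using pos by auto
qed

section \<open>Labeled triangles\<close>

definition area2 :: "vertices \<Rightarrow> real" where
  "area2 T = cross (T $ 2 - T $ 1) (T $ 3 - T $ 1)"

lemma labeled_triangle_area2_pos:
  assumes "labeled_triangle T"
  shows "0 < area2 T"
  using assms by (simp add: labeled_triangle_def area2_def cross_def det_2)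

lemma measure_filled: "measure lebesgue (filled T) = \<bar>area2 T\<bar> / 2"
  by (simp add: filled_def area2_def measure_triangle)

lemma filled_eq:
  "filled T = {T $ 1 + s *\<^sub>R (T $ 2 - T $ 1) + t *\<^sub>R (T $ 3 - T $ 1) | s t. 0 \<le> s \<and> 0 \<le> t \<and> s + t \<le> 1}"
  unfolding filled_def by (rule convex_hull_3_alt)

section \<open>Affine maps matching the vertices\<close>

definition linear_part :: "vertices \<Rightarrow> vertices \<Rightarrow> real ^ 2 \<Rightarrow> real ^ 2" where
  "linear_part T T' x =
     (cross x (T $ 3 - T $ 1) / area2 T) *\<^sub>R (T' $ 2 - T' $ 1) +
     (cross (T $ 2 - T $ 1) x / area2 T) *\<^sub>R (T' $ 3 - T' $ 1)"

definition affine_map :: "vertices \<Rightarrow> vertices \<Rightarrow> real ^ 2 \<Rightarrow> real ^ 2" where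
  "affine_map T T' x = T' $ 1 + linear_part T T' (x - T $ 1)"

lemma linear_linear_part: "linear (linear_part T T')"
  by (rule linearI)
    (simp_all add: linear_part_def cross_def algebra_simps add_divide_distrib diff_divide_distrib)

text \<open>The coefficients in \<open>linear_part\<close> are Cramer's rule: they recover the
  coordinates of a vector in the basis of edge vectors at vertex 1.\<close>

lemma linear_part_combination:
  assumes "area2 T \<noteq> 0"
  shows "linear_part T T' (s *\<^sub>R (T $ 2 - T $ 1) + t *\<^sub>R (T $ 3 - T $ 1))
    = s *\<^sub>R (T' $ 2 - T' $ 1) + t *\<^sub>R (T' $ 3 - T' $ 1)"
proof -
  have "cross (s *\<^sub>R u + t *\<^sub>R v) v = s * cross u v" "cross u (s *\<^sub>R u + t *\<^sub>R v) = t * cross u v" for u v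
    by (simp_all add: cross_def algebra_simps)
  then show ?thesis
    using assms by (simp add: linear_part_def area2_def)
qed

lemma affine_map_combination:
  assumes "area2 T \<noteq> 0"
  shows "affine_map T T' (T $ 1 + s *\<^sub>R (T $ 2 - T $ 1) + t *\<^sub>R (T $ 3 - T $ 1))
    = T' $ 1 + s *\<^sub>R (T' $ 2 - T' $ 1) + t *\<^sub>R (T' $ 3 - T' $ 1)"
  using linear_part_combination[OF assms] by (simp add: affine_map_def add.assoc)

lemma affine_map_vertex:
  assumes "area2 T \<noteq> 0"
  shows "affine_map T T' (T $ i) = T' $ i"
proof -
  note * = affine_map_combination[OF assms, of T']
  have "affine_map T T' (T $ 1) = T' $ 1" "affine_map T T' (T $ 2) = T' $ 2"
      "affine_map T T' (T $ 3) = T' $ 3"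
    using *[of 0 0] *[of 1 0] *[of 0 1] by simp_all
  then show ?thesis
    using exhaust_3[of i] by auto
qed

lemma affine_map_in_filled:
  assumes "area2 T \<noteq> 0" "x \<in> filled T"
  shows "affine_map T T' x \<in> filled T'"
  using assms(2) unfolding filled_eq by (force simp: affine_map_combination[OF assms(1)])

lemma affine_map_inverse:
  assumes "area2 T \<noteq> 0" "area2 T' \<noteq> 0" "x \<in> filled T"
  shows "affine_map T' T (affine_map T T' x) = x"
  using assms(3) unfolding filled_eq
  by (auto simp: affine_map_combination[OF assms(1)] affine_map_combination[OF assms(2)])

lemma dist_affine_map: "dist (affine_map T T' x) (affine_map T T' y) = norm (linear_part T T' (x - y))"
proof -
  have "x - y = (x - T $ 1) - (y - T $ 1)"
    by simp
  then have "linear_part T T' (x - y) = affine_map T T' x - affine_map T T' y"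
    unfolding affine_map_def by (simp only: linear_diff[OF linear_linear_part]) simp
  then show ?thesis
    by (simp add: dist_norm)
qed

lemma ex_lipschitz_affine_map: "\<exists>B. B-lipschitz_on X (affine_map T T')"
proof -
  have "bounded_linear (linear_part T T')"
    using linear_linear_part by (simp add: linear_conv_bounded_linear)
  then obtain B where "0 \<le> B" "\<And>x. norm (linear_part T T' x) \<le> norm x * B"
    using bounded_linear.nonneg_bounded by blast
  then have "B-lipschitz_on X (affine_map T T')"
    by (intro lipschitz_onI, unfold dist_affine_map) (simp_all add: dist_norm mult.commute)
  then show ?thesis ..
qed

lemma homeomorphism_affine_map:
  assumes "area2 T \<noteq> 0" "area2 T' \<noteq> 0"
  shows "homeomorphism (filled T) (filled T') (affine_map T T') (affine_map T' T)"
proof -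
  have "continuous_on X (affine_map T T')" for X T T'
    using ex_lipschitz_affine_map lipschitz_on_continuous_on by blast
  then show ?thesis
    using assms
    by (intro homeomorphismI) (auto simp: affine_map_in_filled affine_map_inverse)
qed

lemma label_preserving_homeo_affine_map:
  assumes "area2 T \<noteq> 0" "area2 T' \<noteq> 0"
  shows "label_preserving_homeo T T' (affine_map T T')"
  using homeomorphism_affine_map[OF assms] affine_map_vertex[OF assms(1)]
  by (auto simp: label_preserving_homeo_def)

section \<open>Inner products of edges, angles and congruence\<close>

definition edge_inner :: "vertices \<Rightarrow> 3 \<Rightarrow> 3 \<Rightarrow> 3 \<Rightarrow> real" where
  "edge_inner T i j k = (T $ j - T $ i) \<bullet> (T $ k - T $ i)"

text \<open>The three equations say that the edge vectors at vertex 1 have the same Gram matrix in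
  both triangles, so the linear part preserves norms.\<close>

lemma label_isometry_affine_map:
  assumes "area2 T \<noteq> 0" "area2 T' \<noteq> 0"
    and eq: "edge_inner T' 1 2 2 = edge_inner T 1 2 2" "edge_inner T' 1 2 3 = edge_inner T 1 2 3"
      "edge_inner T' 1 3 3 = edge_inner T 1 3 3"
  shows "label_isometry T T' (affine_map T T')"
proof -
  have norm_eq: "norm (linear_part T T' x) = norm x" for x
  proof -
    let ?u = "T $ 2 - T $ 1" and ?v = "T $ 3 - T $ 1"
    let ?u' = "T' $ 2 - T' $ 1" and ?v' = "T' $ 3 - T' $ 1"
    define s where "s = cross x ?v / area2 T"
    define t where "t = cross ?u x / area2 T"
    \<comment> \<open>Cramer's rule with the denominator cleared.\<close>
    have "area2 T *\<^sub>R x = cross x ?v *\<^sub>R ?u + cross ?u x *\<^sub>R ?v"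
      by (simp add: vec_eq_iff forall_2 area2_def cross_def) algebra
    then have "x = (1 / area2 T) *\<^sub>R (cross x ?v *\<^sub>R ?u + cross ?u x *\<^sub>R ?v)"
      using assms(1) by (metis scaleR_scaleR nonzero_divide_eq_eq scaleR_one)
    then have x: "x = s *\<^sub>R ?u + t *\<^sub>R ?v"
      by (simp add: s_def t_def scaleR_add_right)
    have inner: "(s *\<^sub>R a + t *\<^sub>R b) \<bullet> (s *\<^sub>R a + t *\<^sub>R b)
        = s * s * (a \<bullet> a) + 2 * s * t * (a \<bullet> b) + t * t * (b \<bullet> b)" for a b :: "real ^ 2"
      by (simp add: inner_simps inner_commute algebra_simps)
    have "linear_part T T' x = s *\<^sub>R ?u' + t *\<^sub>R ?v'"
      by (simp add: linear_part_def s_def t_def)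
    then have "linear_part T T' x \<bullet> linear_part T T' x = x \<bullet> x"
      using eq by (simp only: x inner edge_inner_def)
    then show ?thesis
      by (simp add: norm_eq_sqrt_inner)
  qed
  note hom = homeomorphism_affine_map[OF assms(1,2)]
  then have "bij_betw (affine_map T T') (filled T) (filled T')"
    by (intro bij_betw_byWitness[where f' = "affine_map T' T"]) (auto simp: homeomorphism_def)
  moreover have "dist (affine_map T T' x) (affine_map T T' y) = dist x y" for x y
    unfolding dist_affine_map norm_eq by (simp add: dist_norm)
  ultimately show ?thesis
    using affine_map_vertex[OF assms(1)] by (simp add: label_isometry_def)
qed

text \<open>Divided by \<open>(area2 T)\<^sup>2\<close>, this is the angle sum in terms of
  cotangents: their pairwise products add up to 1.\<close>

lemma edge_inner_identity:
  "edge_inner T 1 2 3 * edge_inner T 2 3 1 + edge_inner T 2 3 1 * edge_inner T 3 1 2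
    + edge_inner T 3 1 2 * edge_inner T 1 2 3 = (area2 T)\<^sup>2"
  unfolding edge_inner_def area2_def cross_def inner_2 vector_minus_component by algebra

text \<open>Supplies the positivity needed in \<open>eq_if_sum_pairwise_products_eq\<close>, even
  when one of the angles is obtuse.\<close>

lemma edge_inner_sums:
  shows "edge_inner T 1 2 3 + edge_inner T 2 3 1 = (dist (T $ 1) (T $ 2))\<^sup>2"
    and "edge_inner T 2 3 1 + edge_inner T 3 1 2 = (dist (T $ 2) (T $ 3))\<^sup>2"
    and "edge_inner T 3 1 2 + edge_inner T 1 2 3 = (dist (T $ 3) (T $ 1))\<^sup>2"
  unfolding edge_inner_def dist_norm power2_norm_eq_inner inner_2 vector_minus_component
  by algebra+

lemma area2_cyclic:
  "area2 T = cross (T $ 3 - T $ 2) (T $ 1 - T $ 2)"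
  "area2 T = cross (T $ 1 - T $ 3) (T $ 2 - T $ 3)"
  by (simp_all add: area2_def cross_def algebra_simps)

lemma vertices_distinct:
  assumes "area2 T \<noteq> 0"
  shows "T $ 1 \<noteq> T $ 2" "T $ 2 \<noteq> T $ 3" "T $ 3 \<noteq> T $ 1"
  using assms by (auto simp: area2_def cross_def)

section \<open>Rigidity of triangles of equal area\<close>

definition lipschitz_homeo :: "real \<Rightarrow> vertices \<Rightarrow> vertices \<Rightarrow> bool" where
  "lipschitz_homeo c T T' \<longleftrightarrow> (\<exists>f. label_preserving_homeo T T' f \<and> c-lipschitz_on (filled T) f)"

lemma label_isometry_if_lipschitz_homeo:
  assumes pos: "0 < area2 T" and eq: "area2 T' = area2 T"
    and lip: "\<And>e. 1 < e \<Longrightarrow> lipschitz_homeo e T T'"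
  shows "label_isometry T T' (affine_map T T')"
proof -
  have ex: "\<exists>f. e-lipschitz_on (filled T) f \<and> f ` filled T = filled T' \<and> f (T $ i) = T' $ i"
    if "1 < e" for e i
    using lip[OF that] by (auto simp: lipschitz_homeo_def label_preserving_homeo_def homeomorphism_def)
  \<comment> \<open>Cyclic relabelling puts each vertex first in turn, so that
    \<open>corner_inner_le\<close> applies at all three corners.\<close>
  have filled_cyclic: "filled T = convex hull {T $ 2, T $ 3, T $ 1}"
      "filled T = convex hull {T $ 3, T $ 1, T $ 2}" for T
    by (simp_all add: filled_def insert_commute)
  have le: "edge_inner T' 1 2 3 \<le> edge_inner T 1 2 3" "edge_inner T' 2 3 1 \<le> edge_inner T 2 3 1"
      "edge_inner T' 3 1 2 \<le> edge_inner T 3 1 2"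
    unfolding edge_inner_def
    by (rule corner_inner_le; use ex pos eq in \<open>simp only: filled_def[symmetric]
        filled_cyclic[symmetric] area2_def[symmetric] area2_cyclic[symmetric]\<close>)+
  have sums_pos: "0 < edge_inner T 1 2 3 + edge_inner T 2 3 1"
      "0 < edge_inner T 2 3 1 + edge_inner T 3 1 2"
      "0 < edge_inner T 3 1 2 + edge_inner T 1 2 3" if "0 < area2 T" for T
    using vertices_distinct[of T] that by (simp_all add: edge_inner_sums)
  have pos': "0 < area2 T'"
    using pos eq by simp
  have "edge_inner T' 1 2 3 * edge_inner T' 2 3 1 + edge_inner T' 2 3 1 * edge_inner T' 3 1 2
      + edge_inner T' 3 1 2 * edge_inner T' 1 2 3
      = edge_inner T 1 2 3 * edge_inner T 2 3 1 + edge_inner T 2 3 1 * edge_inner T 3 1 2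
      + edge_inner T 3 1 2 * edge_inner T 1 2 3"
    by (simp only: edge_inner_identity eq)
  note eq_if_sum_pairwise_products_eq[OF le sums_pos[OF pos] sums_pos[OF pos'] this]
  \<comment> \<open>The squared sides at vertex 1 are sums of the inner products already shown to
    agree, which completes the Gram matrix.\<close>
  moreover have "edge_inner T 1 2 2 = edge_inner T 1 2 3 + edge_inner T 2 3 1"
      "edge_inner T 1 3 3 = edge_inner T 3 1 2 + edge_inner T 1 2 3" for T
    unfolding edge_inner_def by (simp_all add: inner_2 algebra_simps)
  ultimately show ?thesis
    using pos eq by (intro label_isometry_affine_map) simp_all
qed

section \<open>The infimum of Lipschitz constants as a real number\<close>

lemma Lipschitz_const_le_iff:
  assumes "0 \<le> c"
  shows "Lipschitz_const S f \<le> ereal c \<longleftrightarrow> c-lipschitz_on S f"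
proof -
  have "Lipschitz_const S f \<le> ereal c
      \<longleftrightarrow> (\<forall>x\<in>S. \<forall>y\<in>S. x \<noteq> y \<longrightarrow> dist (f x) (f y) / dist x y \<le> c)"
  proof -
    have "Lipschitz_const S f \<le> ereal c \<longleftrightarrow>
        (\<forall>x\<in>S. \<forall>y\<in>S. x \<noteq> y \<longrightarrow> ereal (dist (f x) (f y) / dist x y) \<le> ereal c)"
      unfolding Lipschitz_const_def Sup_le_iff by blast
    then show ?thesis
      by simp
  qed
  also have "\<dots> \<longleftrightarrow> (\<forall>x\<in>S. \<forall>y\<in>S. dist (f x) (f y) \<le> c * dist x y)"
    by (intro ball_cong refl) (auto simp: pos_divide_le_eq)
  \<comment> \<open>\<open>lipschitz_on\<close> includes nonnegativity of the constant, which the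
    supremum does not enforce when \<open>S\<close> has at most one point.\<close>
  finally show ?thesis
    using assms by (simp add: lipschitz_on_def)
qed

definition dilation :: "vertices \<Rightarrow> vertices \<Rightarrow> real" where
  "dilation T T' =
     real_of_ereal (Inf {Lipschitz_const (filled T) f | f. label_preserving_homeo T T' f})"

lemma L_eq_ln_dilation: "L T T' = ln (dilation T T')"
  by (simp add: L_def dilation_def)

text \<open>The infimum is finite, being bounded below by the ratio of an edge and above by a
  Lipschitz constant of the affine map. Hence \<open>dilation\<close> represents it faithfully, and
  extended reals can be left behind.\<close>

lemma
  assumes T: "area2 T \<noteq> 0" and T': "area2 T' \<noteq> 0"
  shows edge_ratio_le_dilation: "dist (T' $ 1) (T' $ 2) / dist (T $ 1) (T $ 2) \<le> dilation T T'"
    and dilation_le: "lipschitz_homeo c T T' \<Longrightarrow> dilation T T' \<le> c"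
    and lipschitz_homeo_if_dilation_less: "dilation T T' < c \<Longrightarrow> lipschitz_homeo c T T'"
proof -
  let ?X = "{Lipschitz_const (filled T) f | f. label_preserving_homeo T T' f}"
  let ?q = "dist (T' $ 1) (T' $ 2) / dist (T $ 1) (T $ 2)"
  have ge: "ereal ?q \<le> Inf ?X"
  proof (rule Inf_greatest, clarify)
    fix f assume "label_preserving_homeo T T' f"
    then have "f (T $ i) = T' $ i" for i
      by (simp add: label_preserving_homeo_def)
    then show "ereal ?q \<le> Lipschitz_const (filled T) f"
      unfolding Lipschitz_const_def using vertices_distinct(1)[OF T]
      by (intro Sup_upper CollectI exI[of _ "T $ 1"] exI[of _ "T $ 2"]) (simp add: vertex_in_filled)
  qed
  have le: "Inf ?X \<le> ereal c" if "lipschitz_homeo c T T'" for c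
  proof -
    obtain f where f: "label_preserving_homeo T T' f" "c-lipschitz_on (filled T) f"
      using \<open>lipschitz_homeo c T T'\<close> by (auto simp: lipschitz_homeo_def)
    then have "Lipschitz_const (filled T) f \<le> ereal c"
      using lipschitz_on_nonneg Lipschitz_const_le_iff by blast
    then show ?thesis
      using f(1) by (intro Inf_lower2[of "Lipschitz_const (filled T) f"]) auto
  qed
  obtain B where "B-lipschitz_on (filled T) (affine_map T T')"
    using ex_lipschitz_affine_map by blast
  then have "lipschitz_homeo B T T'"
    using label_preserving_homeo_affine_map[OF T T'] by (auto simp: lipschitz_homeo_def)
  then have Inf_eq: "Inf ?X = ereal (dilation T T')"
    using le ge unfolding dilation_def by (cases "Inf ?X") force+
  show ratio: "?q \<le> dilation T T'"
    using ge by (simp add: Inf_eq)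
  show "dilation T T' \<le> c" if "lipschitz_homeo c T T'"
    using le[OF that] by (simp add: Inf_eq)
  show "lipschitz_homeo c T T'" if "dilation T T' < c"
  proof -
    have "Inf ?X < ereal c"
      using that by (simp add: Inf_eq)
    then obtain f where "label_preserving_homeo T T' f" "Lipschitz_const (filled T) f < ereal c"
      unfolding Inf_less_iff by blast
    \<comment> \<open>The edge ratio forces \<open>c\<close> to be nonnegative, as
      \<open>Lipschitz_const_le_iff\<close> requires.\<close>
    moreover have "0 \<le> c"
      using that ratio order_trans[of 0 ?q "dilation T T'"] by simp
    ultimately show ?thesis
      using Lipschitz_const_le_iff less_imp_le unfolding lipschitz_homeo_def by blast
  qed
qed

lemma dilation_pos:
  assumes "area2 T \<noteq> 0" "area2 T' \<noteq> 0"
  shows "0 < dilation T T'"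
proof -
  have "0 < dist (T' $ 1) (T' $ 2) / dist (T $ 1) (T $ 2)"
    using vertices_distinct(1) assms by simp
  then show ?thesis
    using edge_ratio_le_dilation[OF assms] by linarith
qed

lemma dilation_self:
  assumes "area2 T \<noteq> 0"
  shows "dilation T T = 1"
proof (rule antisym)
  have "label_preserving_homeo T T (\<lambda>x. x)"
    using homeomorphism_ident by (auto simp: label_preserving_homeo_def)
  moreover have "1-lipschitz_on (filled T) (\<lambda>x. x)"
    by (simp add: lipschitz_on_def)
  ultimately show "dilation T T \<le> 1"
    using dilation_le[OF assms assms] by (auto simp: lipschitz_homeo_def)
  show "1 \<le> dilation T T"
    using edge_ratio_le_dilation[OF assms assms] vertices_distinct(1)[OF assms] by simp
qed

lemma lipschitz_homeo_trans:
  assumes "lipschitz_homeo c T T'" "lipschitz_homeo d T' T''"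
  shows "lipschitz_homeo (d * c) T T''"
proof -
  obtain f g where f: "label_preserving_homeo T T' f" "c-lipschitz_on (filled T) f"
      and g: "label_preserving_homeo T' T'' g" "d-lipschitz_on (filled T') g"
    using assms by (auto simp: lipschitz_homeo_def)
  obtain f' g' where f': "homeomorphism (filled T) (filled T') f f'"
      and g': "homeomorphism (filled T') (filled T'') g g'"
    using f(1) g(1) by (auto simp: label_preserving_homeo_def)
  have "label_preserving_homeo T T'' (g \<circ> f)"
    using homeomorphism_compose[OF f' g'] f(1) g(1) by (auto simp: label_preserving_homeo_def)
  moreover have "(d * c)-lipschitz_on (filled T) (g \<circ> f)"
    using f(2) g(2) f' by (intro lipschitz_on_compose) (simp_all add: homeomorphism_def)
  ultimately show ?thesis
    by (auto simp: lipschitz_homeo_def)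
qed

text \<open>Homeomorphisms within \<open>h\<close> of the two infima compose to one with constant at
  most the product; then \<open>h\<close> tends to 0.\<close>

lemma dilation_submultiplicative:
  assumes T: "area2 T \<noteq> 0" and T': "area2 T' \<noteq> 0" and T'': "area2 T'' \<noteq> 0"
  shows "dilation T T'' \<le> dilation T T' * dilation T' T''"
proof (rule field_le_epsilon)
  fix e :: real assume "0 < e"
  let ?x = "dilation T T'" and ?y = "dilation T' T''"
  have "((\<lambda>h. (?y + h) * (?x + h)) \<longlongrightarrow> (?y + 0) * (?x + 0)) (at_right 0)"
    by (intro tendsto_intros)
  moreover have "dilation T T'' \<le> (?y + h) * (?x + h)" if "0 < h" for h
    using that
    by (intro dilation_le[OF T T''] lipschitz_homeo_trans[where T' = T'] lipschitz_homeo_if_dilation_less[OF T T']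
        lipschitz_homeo_if_dilation_less[OF T' T'']) simp_all
  ultimately have "dilation T T'' \<le> (?y + 0) * (?x + 0)"
    by (intro tendsto_lowerbound[where F = "at_right 0"])
      (auto simp: eventually_at_filter)
  then show "dilation T T'' \<le> ?x * ?y + e"
    using \<open>0 < e\<close> by (simp add: mult.commute)
qed

section \<open>The metric axioms on equivalence classes\<close>

theorem theorem2:
  fixes A :: real
  assumes "A > 0"
  shows "asymmetric_metric_on (triangle_classes A) L_class"
proof -
  \<comment> \<open>The counter-clockwise orientation fixes the sign, so equal areas give equal
    \<open>area2\<close>.\<close>
  have area2: "0 < area2 T" "area2 T = 2 * A" if "T \<in> triangles_of_area A" for T
    using that labeled_triangle_area2_pos[of T] by (auto simp: triangles_of_area_def measure_filled)
  then have nz: "area2 T \<noteq> 0" if "T \<in> triangles_of_area A" for T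
    using that by force
  let ?c = "\<lambda>T. triangle_equiv A `` {T}"
  show ?thesis
    unfolding asymmetric_metric_on_def
  proof (intro conjI ballI impI)
    fix X assume "X \<in> triangle_classes A"
    then obtain T where "T \<in> triangles_of_area A" "X = ?c T"
      unfolding triangle_classes_def by (rule quotientE)
    then show "L_class X X = 0"
      by (simp add: L_class_eq L_eq_ln_dilation dilation_self nz)
  next
    fix X Y assume "X \<in> triangle_classes A" "Y \<in> triangle_classes A" and ne: "X \<noteq> Y"
    then obtain T T' where T: "T \<in> triangles_of_area A" "X = ?c T"
        and T': "T' \<in> triangles_of_area A" "Y = ?c T'"
      unfolding triangle_classes_def by (metis quotientE)
    \<comment> \<open>Otherwise every constant above 1 is realized by a homeomorphism, and rigidity
      puts \<open>T\<close> and \<open>T'\<close> in the same class.\<close>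
    have "1 < dilation T T'"
    proof (rule ccontr)
      assume "\<not> 1 < dilation T T'"
      then have "lipschitz_homeo e T T'" if "1 < e" for e
        using that by (intro lipschitz_homeo_if_dilation_less nz T(1) T'(1)) simp
      then have "label_isometry T T' (affine_map T T')"
        using area2 T(1) T'(1) by (intro label_isometry_if_lipschitz_homeo) simp_all
      then have "(T, T') \<in> triangle_equiv A"
        using T(1) T'(1) by (auto simp: triangle_equiv_def)
      then show False
        using ne T(2) T'(2) equiv_class_eq[OF equiv_triangle_equiv] by blast
    qed
    then show "0 < L_class X Y"
      using T T' by (simp add: L_class_eq L_eq_ln_dilation)
  next
    fix X Y Z assume "X \<in> triangle_classes A" "Y \<in> triangle_classes A" "Z \<in> triangle_classes A"
    then obtain T T' T'' where T: "T \<in> triangles_of_area A" "X = ?c T"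
        and T': "T' \<in> triangles_of_area A" "Y = ?c T'"
        and T'': "T'' \<in> triangles_of_area A" "Z = ?c T''"
      unfolding triangle_classes_def by (metis quotientE)
    note pos = dilation_pos[OF nz nz]
    have "ln (dilation T T'') \<le> ln (dilation T T' * dilation T' T'')"
      using T(1) T'(1) T''(1) dilation_submultiplicative[OF nz nz nz] pos
      by (intro ln_mono) simp_all
    also have "\<dots> = ln (dilation T T') + ln (dilation T' T'')"
      using pos[OF T(1) T'(1)] pos[OF T'(1) T''(1)] by (simp add: ln_mult)
    finally show "L_class X Z \<le> L_class X Y + L_class Y Z"
      using T T' T'' by (simp add: L_class_eq L_eq_ln_dilation)
  qed
qed

end
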